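(* For every integer $n\ge 3$, there exists a collection $\mathbf{T}=(T_1,\dots,T_n)$ of $n$ (not necessarily distinct) tournaments on a common vertex set $V$ with $|V|=n$ such that all but two of the tournaments $T_1,\dots,T_n$ are strongly connected and there is no $\mathbf{T}$-transversal that is a directed Hamilton cycle on $V$.
   Context: A tournament on a finite vertex set $V$ is an orientation of the complete graph on $V$. A tournament is strongly connected if for every pair of vertices $x,y$ there is a directed path from $x$ to $y$. For a collection $\mathbf{T}=(T_1,\dots,T_m)$ of tournaments on a common vertex set $V$, an $m$-edge directed graph $\mathcal{D}$ with vertices in $V$ is a $\mathbf{T}$-transversal if there is a bijection $\phi:E(\mathcal{D})\to[m]=\{1,\dots,m\}$ with $e\in E(T_{\phi(e)})$ for all $e\in E(\mathcal{D})$. A directed Hamilton cycle on $V$ is a (consistently oriented) directed cycle $v_1\to v_2\to\cdots\to v_n\to v_1$ visiting every vertex of $V$ exactly once. Exceptions are counted by index in the collection. *)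

theory Defs
  imports "Graph_Theory.Digraph_Component"
begin

definition tournament_on :: "'a set \<Rightarrow> 'a pair_pre_digraph \<Rightarrow> bool" where
  "tournament_on V G \<longleftrightarrow> pair_digraph G \<and> pverts G = V \<and>
     (\<forall>u\<in>V. \<forall>v\<in>V. u \<noteq> v \<longrightarrow> ((u, v) \<in> parcs G \<longleftrightarrow> (v, u) \<notin> parcs G))"

text \<open>The collection \<open>(T\<^sub>1, \<dots>, T\<^sub>m)\<close> is a function on indices; only its
  values on \<open>{1..m}\<close> matter, and repetitions are allowed.\<close>

definition transversal :: "'a set \<Rightarrow> nat \<Rightarrow> (nat \<Rightarrow> 'a pair_pre_digraph) \<Rightarrow> 'a pair_pre_digraph \<Rightarrow> bool" where
  "transversal V m T D \<longleftrightarrow> pair_digraph D \<and> pverts D \<subseteq> V \<and> card (parcs D) = m \<and>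
     (\<exists>\<phi>. bij_betw \<phi> (parcs D) {1..m} \<and> (\<forall>e\<in>parcs D. e \<in> parcs (T (\<phi> e))))"

text \<open>\<^const>\<open>pre_digraph.cycle\<close> already says that no vertex is visited twice, so covering
  \<open>V\<close> by the tails of the arcs means that every vertex is visited exactly once. It does not
  exclude loops and 2-cycles, which can only cover \<open>V\<close> when \<open>V\<close> has at most two elements.\<close>

definition directed_Hamilton_cycle_on :: "'a set \<Rightarrow> 'a pair_pre_digraph \<Rightarrow> bool" where
  "directed_Hamilton_cycle_on V D \<longleftrightarrow> pverts D = V \<and>
     (\<exists>p. pre_digraph.cycle (with_proj D) p \<and> set p = parcs D \<and> fst ` set p = V)"

end

theory Submission
  imports Defs
begin

text \<open>Let \<open>P\<close> be the transitive tournament on \<open>{1..n}\<close> in which every arc descends, and let \<open>S\<close>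
  be \<open>P\<close> with the arcs \<open>(k+1, k)\<close> reversed, so that \<open>1 \<rightarrow> 2 \<rightarrow> \<dots> \<rightarrow> n \<rightarrow> 1\<close> makes \<open>S\<close> strongly
  connected. Take \<open>n - 2\<close> copies of \<open>S\<close> and two copies of \<open>P\<close>. For every \<open>k < n\<close> a Hamilton cycle
  has to leave the set \<open>{1..k}\<close>, and the only available arc doing so is \<open>(k, k+1)\<close>, which is not
  in \<open>P\<close>. These \<open>n - 1\<close> arcs leave room for only one arc of \<open>P\<close>, whereas a transversal needs two.\<close>

definition descending_tournament :: "nat \<Rightarrow> nat pair_pre_digraph" where
  "descending_tournament n =
     \<lparr>pverts = {1..n}, parcs = {(i, j). i \<in> {1..n} \<and> j \<in> {1..n} \<and> j < i}\<rparr>"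

definition flipped_path_tournament :: "nat \<Rightarrow> nat pair_pre_digraph" where
  "flipped_path_tournament n =
     \<lparr>pverts = {1..n},
      parcs = {(i, j). i \<in> {1..n} \<and> j \<in> {1..n} \<and> (j = Suc i \<or> Suc j < i)}\<rparr>"

lemma pair_digraphI_irrefl:
  assumes "finite (pverts G)" and "parcs G \<subseteq> pverts G \<times> pverts G"
    and "\<And>v. (v, v) \<notin> parcs G"
  shows "pair_digraph G"
proof
  show "finite (parcs G)"
    using assms(1,2) by (meson finite_SigmaI finite_subset)
qed (use assms in auto)

lemma tournament_on_descending: "tournament_on {1..n} (descending_tournament n)"
  unfolding tournament_on_def
proof (intro conjI)
  show "pair_digraph (descending_tournament n)"
    by (rule pair_digraphI_irrefl) (auto simp: descending_tournament_def)
qed (auto simp: descending_tournament_def)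

lemma tournament_on_flipped_path: "tournament_on {1..n} (flipped_path_tournament n)"
  unfolding tournament_on_def
proof (intro conjI)
  show "pair_digraph (flipped_path_tournament n)"
    by (rule pair_digraphI_irrefl) (auto simp: flipped_path_tournament_def)
qed (auto simp: flipped_path_tournament_def)

lemma not_strongly_connected_descending:
  assumes "n \<ge> 2"
  shows "\<not> strongly_connected (descending_tournament n)"
proof
  assume "strongly_connected (descending_tournament n)"
  then have "(1, 2) \<in> rtrancl_on {1..n} (parcs (descending_tournament n))"
    using assms unfolding strongly_connected_def reachable_def
    by (simp add: descending_tournament_def)
  \<comment> \<open>Arcs only descend, so every vertex reachable from \<open>1\<close> is at most
    \<open>1\<close>; the absurd inequality is this invariant at the endpoint
    \<open>2\<close>.\<close>
  then have "2 \<le> (1 :: nat)"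
    by induct (auto simp: descending_tournament_def)
  then show False by simp
qed

lemma strongly_connected_flipped_path:
  assumes "n \<ge> 3"
  shows "strongly_connected (flipped_path_tournament n)"
proof -
  let ?R = "rtrancl_on {1..n} (parcs (flipped_path_tournament n))"
  have up: "(u, v) \<in> ?R" if "u \<le> v" "1 \<le> u" "v \<le> n" for u v
    using that
  proof (induct v rule: dec_induct)
    case (step m)
    then have "(m, Suc m) \<in> parcs (flipped_path_tournament n)"
      by (simp add: flipped_path_tournament_def)
    then show ?case
      using step by (auto intro: rtrancl_on_into_rtrancl_on)
  qed simp
  \<comment> \<open>The closing arc needs \<open>Suc 1 < n\<close>, which is where
    \<open>n \<ge> 3\<close> enters.\<close>
  have "(n, 1) \<in> parcs (flipped_path_tournament n)"
    using assms by (simp add: flipped_path_tournament_def)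
  then have down: "(n, 1) \<in> ?R"
    using assms rtrancl_on_into_rtrancl_on[of n n] by simp
  have "(u, v) \<in> ?R" if "u \<in> {1..n}" "v \<in> {1..n}" for u v
  proof -
    have "(u, n) \<in> ?R" "(1, v) \<in> ?R"
      using up[of u n] up[of 1 v] that by simp_all
    then show ?thesis
      using down by (meson rtrancl_on_trans)
  qed
  then show ?thesis
    using assms unfolding strongly_connected_def reachable_def
    by (simp add: flipped_path_tournament_def)
qed

text \<open>If no arc of the walk leaves \<open>A\<close>, each head is again in \<open>A\<close>,
  so membership propagates from the start. This and the next lemma leave a closed walk two options:
  all its tails in \<open>A\<close>, or none.\<close>

lemma pcas_closed:
  assumes "pcas u p v" and "\<forall>(x, y)\<in>set p. x \<in> A \<longrightarrow> y \<in> A" and "u \<in> A"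
  shows "v \<in> A \<and> fst ` set p \<subseteq> A"
  using assms
proof (induct p arbitrary: u)
  case (Cons e p)
  have "snd e \<in> A"
    using Cons.prems by (cases e) auto
  with Cons.hyps[of "snd e"] Cons.prems show ?case
    by auto
qed simp

text \<open>By \<open>pcas_closed\<close>, a walk that met \<open>A\<close> would be trapped there
  and could not end outside.\<close>

lemma pcas_closed_avoid:
  assumes "pcas u p v" and "\<forall>(x, y)\<in>set p. x \<in> A \<longrightarrow> y \<in> A" and "v \<notin> A"
  shows "fst ` set p \<inter> A = {}"
  using assms
proof (induct p arbitrary: u)
  case (Cons e p)
  have "u \<notin> A"
    using pcas_closed[OF Cons.prems(1,2)] Cons.prems(3) by blast
  moreover have "fst ` set p \<inter> A = {}"
    using Cons.hyps[of "snd e"] Cons.prems by auto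
  ultimately show ?case
    using Cons.prems(1) by auto
qed simp

text \<open>Otherwise the base point \<open>u\<close> of the closed walk decides: \<open>u\<close>
  in \<open>A\<close> keeps every tail in \<open>A\<close>, so \<open>y\<close> is missed, and
  \<open>u\<close> outside \<open>A\<close> keeps every tail outside, so \<open>x\<close> is
  missed.\<close>

lemma Hamilton_cycle_leaves_set:
  assumes "directed_Hamilton_cycle_on V D" and "x \<in> V \<inter> A" and "y \<in> V - A"
  obtains a b where "(a, b) \<in> parcs D" "a \<in> A" "b \<notin> A"
proof -
  obtain p u where p: "pcas u p u" "set p = parcs D" "fst ` set p = V"
    using assms(1)
    unfolding directed_Hamilton_cycle_on_def pre_digraph.cycle_def pre_digraph.awalk_def
      cas_with_proj_eq by auto
  have "\<exists>a b. (a, b) \<in> set p \<and> a \<in> A \<and> b \<notin> A"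
  proof (rule ccontr)
    assume "\<not> ?thesis"
    then have closed: "\<forall>(x, y)\<in>set p. x \<in> A \<longrightarrow> y \<in> A"
      by blast
    show False
      using pcas_closed[OF p(1) closed] pcas_closed_avoid[OF p(1) closed] p(3) assms(2,3)
      by blast
  qed
  then show thesis
    using p(2) that by blast
qed

theorem proposition1p5:
  fixes n :: nat
  assumes "n \<ge> 3"
  shows "\<exists>(V :: nat set) (T :: nat \<Rightarrow> nat pair_pre_digraph).
           finite V \<and> card V = n \<and>
           (\<forall>i\<in>{1..n}. tournament_on V (T i)) \<and>
           card {i\<in>{1..n}. \<not> strongly_connected (T i)} = 2 \<and>
           \<not> (\<exists>D. transversal V n T D \<and> directed_Hamilton_cycle_on V D)"
proof -
  define V where "V = {1..n}"
  define T where
    "T i = (if i < n - 1 then flipped_path_tournament n else descending_tournament n)" for i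
  have "{i\<in>{1..n}. \<not> strongly_connected (T i)} = {n - 1, n}"
    using assms strongly_connected_flipped_path[of n] not_strongly_connected_descending[of n]
    by (auto simp: T_def split: if_splits)
  then have exceptions: "card {i\<in>{1..n}. \<not> strongly_connected (T i)} = 2"
    using assms by simp
  have False if tr: "transversal V n T D" and ham: "directed_Hamilton_cycle_on V D" for D
  proof -
    obtain \<phi> where \<phi>: "bij_betw \<phi> (parcs D) {1..n}" "\<And>e. e \<in> parcs D \<Longrightarrow> e \<in> parcs (T (\<phi> e))"
      and card: "card (parcs D) = n"
      using tr unfolding transversal_def by auto
    \<comment> \<open>An infinite set has \<open>card\<close> equal to \<open>0\<close>, so a
      positive count gives finiteness.\<close>
    have fin: "finite (parcs D)"
      using card assms by (intro card_ge_0_finite) simp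
    have ascent: "j \<le> Suc i" if "(i, j) \<in> parcs D" for i j
      using \<phi>(2)[OF that]
      by (auto simp: T_def flipped_path_tournament_def descending_tournament_def split: if_splits)
    define P where "P = (\<lambda>k. (k, Suc k)) ` {1..<n}"
    have "(k, Suc k) \<in> parcs D" if k: "k \<in> {1..<n}" for k
    proof -
      \<comment> \<open>The cut separates \<open>1\<close> from \<open>n\<close>. With
        \<open>ascent\<close>, k < b \<le> Suc a \<le> Suc k pins down the crossing arc.\<close>
      obtain a b where ab: "(a, b) \<in> parcs D" "a \<in> {..k}" "b \<notin> {..k}"
        using Hamilton_cycle_leaves_set[OF ham, of 1 "{..k}" n] k by (auto simp: V_def)
      with ascent[OF ab(1)] have "a = k" "b = Suc k"
        by auto
      with ab(1) show ?thesis
        by simp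
    qed
    then have P: "P \<subseteq> parcs D"
      by (auto simp: P_def)
    \<comment> \<open>The indices \<open>n - 1\<close> and \<open>n\<close> carry the two descending
      tournaments; their arcs \<open>d\<close> and \<open>e\<close> descend and so lie outside
      \<open>P\<close>.\<close>
    have "n - 1 \<in> \<phi> ` parcs D" "n \<in> \<phi> ` parcs D"
      using \<phi>(1) assms unfolding bij_betw_def by auto
    then obtain d e where d: "d \<in> parcs D" "\<phi> d = n - 1" and e: "e \<in> parcs D" "\<phi> e = n"
      by auto
    have "d \<noteq> e"
      using d e assms by auto
    moreover have "{d, e} \<subseteq> parcs (descending_tournament n)"
      using \<phi>(2)[OF d(1)] \<phi>(2)[OF e(1)] unfolding d(2) e(2) by (auto simp: T_def split: if_splits)
    then have "d \<notin> P" "e \<notin> P"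
      by (auto simp: descending_tournament_def P_def)
    moreover have "card P = n - 1" "finite P"
      by (simp_all add: P_def card_image inj_on_def)
    \<comment> \<open>This is one arc more than \<open>D\<close> has.\<close>
    ultimately have "card (insert d (insert e P)) = n + 1"
      using assms by simp
    moreover have "card (insert d (insert e P)) \<le> card (parcs D)"
      using P d(1) e(1) fin by (intro card_mono) auto
    ultimately show False
      using card by simp
  qed
  moreover have "\<forall>i\<in>{1..n}. tournament_on V (T i)"
    using tournament_on_descending tournament_on_flipped_path by (simp add: T_def V_def)
  moreover have "finite V" "card V = n"
    by (simp_all add: V_def)
  ultimately show ?thesis
    using exceptions by blast
qed

end
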